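(* Let $b>a>0$ and $\gamma=\frac{ab}{b-a}$ (so that $\gamma>a$). Let $\hat p_4$ be a real polynomial of degree $4$ for which there is a real polynomial $\hat q_2$ of degree $2$ with $$\hat p_4^2(s)-s\left(s-\frac1a\right)\left(s+\frac1b\right)\left(s-\frac1\gamma\right)\hat q_2^2(s)=1.$$ Then $\hat p_4(s)$ equals, up to a constant multiplier, $$T_2\big(2abs^2+2(a-b)s-1\big),$$ where $T_2(x)=2x^2-1$ is the second Chebyshev polynomial.
   Context: The value of $\gamma$ is the one with $\gamma>a$ for which billiard trajectories within the ellipse $\frac{x^2}{a}+\frac{y^2}{b}=1$ in the Minkowski plane with caustic $\frac{x^2}{a-\gamma}+\frac{y^2}{b+\gamma}=1$ (a hyperbola) are $4$-periodic. *)

theory Defs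
  imports Complex_Main "HOL-Computational_Algebra.Polynomial"
begin

fun Chebyshev_T :: "nat \<Rightarrow> real poly" where
  "Chebyshev_T 0 = 1"
| "Chebyshev_T (Suc 0) = [:0, 1:]"
| "Chebyshev_T (Suc (Suc n)) = [:0, 2:] * Chebyshev_T (Suc n) - Chebyshev_T n"

lemma Chebyshev_T_cos: "poly (Chebyshev_T n) (cos t) = cos (real n * t)"
proof (induction n rule: Chebyshev_T.induct)
  case (3 n)
  have "cos (real (Suc n) * t + t) + cos (real (Suc n) * t - t) = 2 * cos t * cos (real (Suc n) * t)"
    by (simp add: cos_add cos_diff)
  moreover have "real (Suc n) * t + t = real (Suc (Suc n)) * t" "real (Suc n) * t - t = real n * t"
    by (simp_all add: algebra_simps)
  ultimately show ?case
    using 3 by simp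
qed simp_all

lemma poly_Chebyshev_T_2: "poly (Chebyshev_T 2) x = 2 * x\<^sup>2 - 1"
  by (simp add: numeral_2_eq_2 power2_eq_square)

lemma caustic_parameter_gt:
  fixes a b \<gamma> :: real
  assumes "b > a" "a > 0" "\<gamma> = a * b / (b - a)"
  shows "\<gamma> > a"
proof -
  have "\<gamma> - a = a\<^sup>2 / (b - a)"
    using assms by (simp add: field_simps power2_eq_square)
  moreover have "a\<^sup>2 / (b - a) > 0"
    using assms by simp
  ultimately show ?thesis by linarith
qed

end

theory Submission
  imports Defs
begin

text \<open>
  Put \<open>u = 2abs\<^sup>2 + 2(a - b)s - 1\<close>. Since \<open>1/\<gamma> = 1/a - 1/b\<close>, the quartic factors as
  \<open>s(s - 1/\<gamma>) \<cdot> (s - 1/a)(s + 1/b) = (u + 1)/(2ab) \<cdot> (u - 1)/(2ab)\<close>, so with \<open>Q = q/(2ab)\<close> the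
  hypothesis is the Pell equation \<open>p\<^sup>2 - (u\<^sup>2 - 1)Q\<^sup>2 = 1\<close>, that is,
  \<open>(p - uQ)(p + uQ) = 1 - Q\<^sup>2\<close>. The right-hand side has degree 4 and, up to the sign of \<open>Q\<close>,
  so has \<open>p + uQ\<close>; hence \<open>p - uQ\<close> is a constant \<open>c\<close>. This gives \<open>Q(Q + 2cu) = 1 - c\<^sup>2\<close>,
  whence \<open>Q = -2cu\<close> and \<open>p = -c(2u\<^sup>2 - 1)\<close>.
\<close>

text \<open>The degree assumed for \<open>p + u * q\<close> fixes the sign of \<open>q\<close>: it
  exhausts the degree of \<open>1 - q\<^sup>2\<close> and leaves only a constant for
  \<open>p - u * q\<close>.\<close>

lemma pell_degree_double_of_factor:
  fixes p q u :: "'a :: field_char_0 poly"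
  assumes pell: "p\<^sup>2 - (u\<^sup>2 - 1) * q\<^sup>2 = 1"
    and deg: "degree u = n" "degree q = n" "degree (p + u * q) = 2 * n" and "n > 0"
  shows "\<exists>c. c \<noteq> 0 \<and> p = smult c (2 * u\<^sup>2 - 1)"
proof -
  have factors: "(p - u * q) * (p + u * q) = 1 - q\<^sup>2"
    using pell by (simp add: algebra_simps power2_eq_square)
  have q2: "degree (q\<^sup>2) = 2 * n"
    using deg \<open>n > 0\<close> by (subst degree_power_eq) auto
  have rhs: "degree (1 - q\<^sup>2) = 2 * n"
    using degree_add_eq_right[of 1 "- q\<^sup>2"] q2 \<open>n > 0\<close> by simp
  then have "1 - q\<^sup>2 \<noteq> 0"
    using \<open>n > 0\<close> by auto
  then have nz: "p - u * q \<noteq> 0" "p + u * q \<noteq> 0"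
    using factors by auto
  then have "degree (p - u * q) = 0"
    using degree_mult_eq[OF nz] deg unfolding factors rhs by simp
  then obtain c where c: "p - u * q = [:c:]"
    by (rule degree_eq_zeroE)
  have p: "p = [:c:] + u * q"
    using c by (simp add: algebra_simps)
  have "q * (q + 2 * [:c:] * u) = 1 - [:c:] * [:c:]"
    using factors unfolding p by (simp add: algebra_simps power2_eq_square)
  then have eq: "q * (q + 2 * [:c:] * u) = [:1 - c\<^sup>2:]"
    by (simp add: one_pCons power2_eq_square)
  \<comment> \<open>Otherwise the product in \<open>eq\<close> would have degree at least
    \<open>n > 0\<close>, yet it is constant.\<close>
  have zero: "q + 2 * [:c:] * u = 0"
  proof (rule ccontr)
    assume "q + 2 * [:c:] * u \<noteq> 0"
    then have "degree (q * (q + 2 * [:c:] * u)) \<ge> n"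
      using deg \<open>n > 0\<close> by (subst degree_mult_eq) auto
    with eq \<open>n > 0\<close> show False by simp
  qed
  have "p = [:c:] + u * (- (2 * [:c:] * u))"
    using p zero by (metis add_eq_0_iff2)
  also have "\<dots> = [:- c:] * (2 * u\<^sup>2 - 1)"
    by (simp add: algebra_simps power2_eq_square)
  finally have "p = smult (- c) (2 * u\<^sup>2 - 1)"
    by simp
  moreover have "- c \<noteq> 0"
    using nz(1) unfolding c by simp
  ultimately show ?thesis by blast
qed

text \<open>The Pell equation is invariant under replacing \<open>q\<close> by \<open>- q\<close>,
  so it suffices that one of \<open>p + u * q\<close> and \<open>p - u * q\<close> has degree
  \<open>2 * n\<close>.\<close>

lemma pell_degree_double:
  fixes p q u :: "'a :: field_char_0 poly"
  assumes pell: "p\<^sup>2 - (u\<^sup>2 - 1) * q\<^sup>2 = 1"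
    and deg: "degree p = 2 * n" "degree u = n" "degree q = n" and "n > 0"
  shows "\<exists>c. c \<noteq> 0 \<and> p = smult c (2 * u\<^sup>2 - 1)"
proof -
  have uq: "degree (u * q) \<le> 2 * n"
    using degree_mult_le[of u q] deg by simp
  have "degree (p + u * q) = 2 * n \<or> degree (p - u * q) = 2 * n"
  proof (rule ccontr)
    assume "\<not> ?thesis"
    with uq deg have "degree (p + u * q) < 2 * n" "degree (p - u * q) < 2 * n"
      using degree_add_le[of p "2 * n" "u * q"] degree_diff_le[of p "2 * n" "u * q"] by auto
    \<comment> \<open>The two polynomials add up to \<open>2p\<close>.\<close>
    then have "coeff (smult 2 p) (2 * n) = 0"
      using coeff_eq_0[of "p + u * q" "2 * n"] coeff_eq_0[of "p - u * q" "2 * n"]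
      by (simp add: add_eq_0_iff)
    then have "coeff p (degree p) = 0"
      using deg by simp
    then have "p = 0"
      by (simp only: leading_coeff_0_iff)
    with deg \<open>n > 0\<close> show False by simp
  qed
  then show ?thesis
    using pell_degree_double_of_factor[of p u q n] pell_degree_double_of_factor[of p u "- q" n] assms
    by auto
qed

theorem proposition8p6:
  fixes a b \<gamma> :: real and p :: "real poly"
  assumes "b > a" and "a > 0"
    and "\<gamma> = a * b / (b - a)"
    and "degree p = 4"
    and "\<exists>q :: real poly. degree q = 2 \<and>
           (\<forall>s. (poly p s)\<^sup>2 - s * (s - 1 / a) * (s + 1 / b) * (s - 1 / \<gamma>) * (poly q s)\<^sup>2 = 1)"
  shows "\<exists>c. c \<noteq> 0 \<and>
           (\<forall>s. poly p s = c * poly (Chebyshev_T 2) (2 * a * b * s\<^sup>2 + 2 * (a - b) * s - 1))"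
proof -
  obtain q :: "real poly" where "degree q = 2" and q:
    "\<And>s. (poly p s)\<^sup>2 - s * (s - 1 / a) * (s + 1 / b) * (s - 1 / \<gamma>) * (poly q s)\<^sup>2 = 1"
    using assms(5) by blast
  define u :: "real poly" where "u = [:- 1, 2 * (a - b), 2 * a * b:]"
  define Q where "Q = smult (1 / (2 * a * b)) q"
  have u: "poly u s = 2 * a * b * s\<^sup>2 + 2 * (a - b) * s - 1" for s
    by (simp add: u_def algebra_simps power2_eq_square)
  have inv_\<gamma>: "1 / \<gamma> = (b - a) / (a * b)"
    using assms(3) by simp
  have D: "s * (s - 1 / a) * (s + 1 / b) * (s - 1 / \<gamma>) = ((poly u s)\<^sup>2 - 1) * (1 / (2 * a * b))\<^sup>2" for s
  proof -
    \<comment> \<open>The root pairs \<open>0, 1/\<gamma>\<close> and \<open>1/a, -1/b\<close> have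
      the same sum, so the two monic quadratics differ only by the constant \<open>1/(ab)\<close>;
      scaling by \<open>2ab\<close> makes this difference 2.\<close>
    have "s * (s - 1 / \<gamma>) = (poly u s + 1) / (2 * a * b)"
      using assms(1,2) unfolding inv_\<gamma> by (simp add: u field_simps power2_eq_square)
    moreover have "(s - 1 / a) * (s + 1 / b) = (poly u s - 1) / (2 * a * b)"
      using assms(1,2) by (simp add: u field_simps power2_eq_square)
    moreover have "s * (s - 1 / a) * (s + 1 / b) * (s - 1 / \<gamma>) =
        (s * (s - 1 / \<gamma>)) * ((s - 1 / a) * (s + 1 / b))"
      by (simp only: mult_ac)
    ultimately show ?thesis
      by (simp only:) (simp add: algebra_simps power2_eq_square diff_divide_distrib add_divide_distrib)
  qed
  \<comment> \<open>Equality at every real point gives equality of polynomials, so that degrees can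
    be compared.\<close>
  have "poly (p\<^sup>2 - (u\<^sup>2 - 1) * Q\<^sup>2) s = poly 1 s" for s
    using q[of s] unfolding D by (simp add: Q_def power_divide mult_ac)
  then have "p\<^sup>2 - (u\<^sup>2 - 1) * Q\<^sup>2 = 1"
    by (metis poly_eq_poly_eq_iff ext)
  moreover have "degree u = 2" "degree Q = 2"
    using assms(1,2) \<open>degree q = 2\<close> by (simp_all add: u_def Q_def)
  ultimately obtain c where "c \<noteq> 0" "p = smult c (2 * u\<^sup>2 - 1)"
    using pell_degree_double[of p u Q 2] assms(4) by auto
  then show ?thesis
    by (intro exI[of _ c]) (simp add: poly_Chebyshev_T_2 u)
qed

end
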